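(* For every non-negative integer $n$ and every integer $s$, \[ 2\sum_{k = 1}^{\lceil n/2 \rceil } \binom n{2k - 1}F_{2k + s} = F_{2n + s + 1} - ( - 1)^s F_{n - s - 1},\qquad 2\sum_{k = 1}^{\lceil n/2 \rceil } \binom n{2k - 1}L_{2k + s} = L_{2n + s + 1} + ( - 1)^s L_{n - s - 1}. \]
   Context: The Fibonacci numbers $F_j$ and Lucas numbers $L_j$ are defined for all integers $j$ by $F_0=0$, $F_1=1$, $L_0=2$, $L_1=1$, $F_j=F_{j-1}+F_{j-2}$, $L_j=L_{j-1}+L_{j-2}$, with $F_{-j}=(-1)^{j-1}F_j$ and $L_{-j}=(-1)^jL_j$. An empty sum equals $0$. *)

theory Defs
  imports Complex_Main "HOL-Number_Theory.Fib"
begin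

definition Fib_int :: "int \<Rightarrow> int" where
  "Fib_int j = (if j \<ge> 0 then int (fib (nat j))
     else (-1) ^ nat (- j - 1) * int (fib (nat (- j))))"

fun lucas :: "nat \<Rightarrow> nat" where
  "lucas 0 = 2"
| "lucas (Suc 0) = 1"
| "lucas (Suc (Suc n)) = lucas (Suc n) + lucas n"

definition Lucas_int :: "int \<Rightarrow> int" where
  "Lucas_int j = (if j \<ge> 0 then int (lucas (nat j))
     else (-1) ^ nat (- j) * int (lucas (nat (- j))))"

lemma Fib_int_neg: "Fib_int (- int m) = (-1) ^ (m + 1) * Fib_int (int m)"
  by (cases m) (auto simp: Fib_int_def nat_add_distrib)

lemma Lucas_int_neg: "Lucas_int (- int m) = (-1) ^ m * Lucas_int (int m)"
  by (cases m) (auto simp: Lucas_int_def nat_add_distrib)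

lemma int_rec_cases:
  fixes j :: int
  obtains m where "j = int m + 2" | "j = 1" | m where "j = - int m"
proof -
  consider "j \<ge> 2" | "j = 1" | "j \<le> 0" by linarith
  then show thesis
  proof cases
    case 1
    then show ?thesis by (intro that(1)[of "nat (j - 2)"]) simp
  next
    case 2
    then show ?thesis by (rule that(2))
  next
    case 3
    then show ?thesis by (intro that(3)[of "nat (- j)"]) simp
  qed
qed

lemma Fib_int_rec: "Fib_int j = Fib_int (j - 1) + Fib_int (j - 2)"
proof (cases j rule: int_rec_cases)
  case 1
  then show ?thesis by (simp add: Fib_int_def nat_add_distrib)
next
  case 2
  then show ?thesis by (simp add: Fib_int_def)
next
  case (3 m)
  have "j - 1 = - int (Suc m)" "j - 2 = - int (Suc (Suc m))"
    using 3 by auto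
  then show ?thesis
    unfolding 3 by (simp only: Fib_int_neg) (simp add: Fib_int_def nat_add_distrib algebra_simps)
qed

lemma Lucas_int_rec: "Lucas_int j = Lucas_int (j - 1) + Lucas_int (j - 2)"
proof (cases j rule: int_rec_cases)
  case 1
  then show ?thesis by (simp add: Lucas_int_def nat_add_distrib)
next
  case 2
  then show ?thesis by (simp add: Lucas_int_def)
next
  case (3 m)
  have "j - 1 = - int (Suc m)" "j - 2 = - int (Suc (Suc m))"
    using 3 by auto
  then show ?thesis
    unfolding 3 by (simp only: Lucas_int_neg) (simp add: Lucas_int_def nat_add_distrib algebra_simps)
qed

end

theory Submission
  imports Defs
begin

text \<open>
  Let \<open>G\<close> satisfy the Fibonacci recurrence on the integers. By Pascal's rule, the sums of
  \<open>C(n,i) G(i+t)\<close> and of \<open>(-1)\<^sup>i C(n,i) G(i+t)\<close> over all \<open>i\<close> are \<open>G(2n+t)\<close> and \<open>(-1)\<^sup>n G(t-n)\<close>;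
  for powers of a root \<open>x\<close> of \<open>x\<^sup>2 = x + 1\<close> this is \<open>1 + x = x\<^sup>2\<close> and \<open>1 - x = -1/x\<close>. Their
  difference is twice the sum over odd \<open>i\<close>. Put \<open>t = s + 1\<close> and reflect \<open>G(s+1-n)\<close>.
\<close>

text \<open>Pascal's rule splits each coefficient of row \<open>Suc n\<close> in two; shifting the
  index in one half pairs \<open>f i\<close> with \<open>f (Suc i)\<close>. An induction on
  \<open>n\<close> thus only has to transform the summand.\<close>

lemma sum_choose_Suc:
  fixes f :: "nat \<Rightarrow> 'a::comm_semiring_1"
  shows "(\<Sum>i\<le>Suc n. of_nat (Suc n choose i) * f i)
       = (\<Sum>i\<le>n. of_nat (n choose i) * (f i + f (Suc i)))"
proof -
  have "(\<Sum>i\<le>n. of_nat (n choose Suc i) * f (Suc i)) + f 0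
      = (\<Sum>i\<le>Suc n. of_nat (n choose i) * f i)"
    by (subst sum.atMost_Suc_shift) (simp add: add.commute)
  \<comment> \<open>The top term drops out, as \<open>n choose Suc n\<close> is zero.\<close>
  also have "\<dots> = (\<Sum>i\<le>n. of_nat (n choose i) * f i)"
    by (simp add: binomial_eq_0)
  finally have "(\<Sum>i\<le>n. of_nat (n choose i) * f i)
      = f 0 + (\<Sum>i\<le>n. of_nat (n choose Suc i) * f (Suc i))"
    by (simp add: add.commute)
  then show ?thesis
    by (subst sum.atMost_Suc_shift) (simp add: algebra_simps sum.distrib)
qed

lemma sum_choose_fib_rec:
  fixes G :: "int \<Rightarrow> 'a::comm_ring_1"
  assumes rec: "\<And>j. G j = G (j - 1) + G (j - 2)"
  shows "(\<Sum>i\<le>n. of_nat (n choose i) * G (int i + t)) = G (2 * int n + t)"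
\<comment> \<open>The offset must vary: merging neighbouring terms replaces \<open>t\<close> by
  \<open>t + 2\<close>.\<close>
proof (induction n arbitrary: t)
  case (Suc n)
  have step: "G (int i + t) + G (int (Suc i) + t) = G (int i + (t + 2))" for i
    using rec[of "int i + (t + 2)"] by (simp add: algebra_simps)
  show ?case
    by (simp only: sum_choose_Suc step Suc.IH) (simp add: algebra_simps)
qed simp

lemma alternating_sum_choose_fib_rec:
  fixes G :: "int \<Rightarrow> 'a::comm_ring_1"
  assumes rec: "\<And>j. G j = G (j - 1) + G (j - 2)"
  shows "(\<Sum>i\<le>n. of_nat (n choose i) * ((-1) ^ i * G (int i + t))) = (-1) ^ n * G (t - int n)"
proof (induction n arbitrary: t)
  case (Suc n)
  \<comment> \<open>Neighbouring terms now differ in sign, so the recurrence leaves a factor -1 and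
    lowers the offset to \<open>t - 1\<close>.\<close>
  have step: "(-1) ^ i * G (int i + t) + (-1) ^ Suc i * G (int (Suc i) + t)
      = - ((-1) ^ i * G (int i + (t - 1)))" for i
    using rec[of "int (Suc i) + t"] by (simp add: algebra_simps)
  show ?case
    by (simp only: sum_choose_Suc step mult_minus_right sum_negf Suc.IH) (simp add: algebra_simps)
qed simp

text \<open>The term \<open>f i - (-1) ^ i * f i\<close> is \<open>2 * f i\<close> for odd
  \<open>i\<close> and 0 for even \<open>i\<close>.\<close>

lemma sum_odd_upto:
  fixes f :: "nat \<Rightarrow> 'a::comm_ring_1"
  shows "2 * (\<Sum>k = 1..(n + 1) div 2. f (2 * k - 1)) = (\<Sum>i\<le>n. f i) - (\<Sum>i\<le>n. (-1) ^ i * f i)"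
proof -
  have "(\<Sum>k = 1..(n + 1) div 2. f (2 * k - 1)) = (\<Sum>i | i \<le> n \<and> odd i. f i)"
    by (rule sum.reindex_bij_witness[of _ "\<lambda>i. (i + 1) div 2" "\<lambda>k. 2 * k - 1"])
       (simp_all, presburger+)
  also have "2 * \<dots> = (\<Sum>i | i \<le> n \<and> odd i. f i - (-1) ^ i * f i)"
    unfolding sum_distrib_left by (rule sum.cong) auto
  also have "\<dots> = (\<Sum>i\<le>n. f i - (-1) ^ i * f i)"
    by (rule sum.mono_neutral_left) auto
  finally show ?thesis
    by (simp add: sum_subtractf)
qed

lemma nat_ceiling_half: "nat \<lceil>real n / 2\<rceil> = (n + 1) div 2"
proof -
  have "\<lceil>real n / 2\<rceil> = int ((n + 1) div 2)"
    by (rule ceiling_unique) (cases "even n"; auto elim!: evenE oddE)+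
  then show ?thesis by simp
qed

lemma sum_odd_choose_fib_rec:
  fixes G :: "int \<Rightarrow> real"
  assumes rec: "\<And>j. G j = G (j - 1) + G (j - 2)"
  shows "2 * (\<Sum>k = 1..nat \<lceil>real n / 2\<rceil>. real (n choose (2 * k - 1)) * G (2 * int k + s))
       = G (2 * int n + s + 1) - (-1) ^ n * G (s + 1 - int n)"
proof -
  \<comment> \<open>Since \<open>k\<close> is at least 1, the natural subtraction
    \<open>2 * k - 1\<close> is not truncated; the missing 1 moves into the offset
    \<open>s + 1\<close>.\<close>
  have "(\<Sum>k = 1..nat \<lceil>real n / 2\<rceil>. real (n choose (2 * k - 1)) * G (2 * int k + s))
      = (\<Sum>k = 1..(n + 1) div 2. real (n choose (2 * k - 1)) * G (int (2 * k - 1) + (s + 1)))"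
    unfolding nat_ceiling_half by (rule sum.cong) (auto simp: of_nat_diff)
  then show ?thesis
    using sum_odd_upto[of "\<lambda>i. real (n choose i) * G (int i + (s + 1))" n]
      sum_choose_fib_rec[of G n "s + 1", OF rec]
      alternating_sum_choose_fib_rec[of G n "s + 1", OF rec]
    by (simp add: algebra_simps)
qed

text \<open>Reflection for \<open>j\<close> of either sign; a parity test avoids a power with a
  possibly negative exponent.\<close>

lemma Fib_int_uminus: "Fib_int (- j) = (if even j then - Fib_int j else Fib_int j)"
proof (cases "j \<ge> 0")
  case True
  then show ?thesis using Fib_int_neg[of "nat j"] by (simp add: even_nat_iff)
next
  case False
  then show ?thesis using Fib_int_neg[of "nat (- j)"] by (simp add: even_nat_iff)
qed

lemma Lucas_int_uminus: "Lucas_int (- j) = (if even j then Lucas_int j else - Lucas_int j)"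
proof (cases "j \<ge> 0")
  case True
  then show ?thesis using Lucas_int_neg[of "nat j"] by (simp add: even_nat_iff)
next
  case False
  then show ?thesis using Lucas_int_neg[of "nat (- j)"] by (simp add: even_nat_iff)
qed

theorem theorem15:
  fixes n :: nat and s :: int
  shows "(2 * (\<Sum>k = 1..nat \<lceil>real n / 2\<rceil>.
            real (n choose (2 * k - 1)) * real_of_int (Fib_int (2 * int k + s)))
         = real_of_int (Fib_int (2 * int n + s + 1))
           - (-1) powi s * real_of_int (Fib_int (int n - s - 1)))
       \<and> (2 * (\<Sum>k = 1..nat \<lceil>real n / 2\<rceil>.
            real (n choose (2 * k - 1)) * real_of_int (Lucas_int (2 * int k + s)))
         = real_of_int (Lucas_int (2 * int n + s + 1))
           + (-1) powi s * real_of_int (Lucas_int (int n - s - 1)))"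
proof
  \<comment> \<open>Reflecting at \<open>j = n - s - 1\<close> gives the sign
    \<open>(-1) powi (n - s)\<close>, and multiplying by \<open>(-1) ^ n\<close> leaves
    \<open>(-1) powi s\<close>.\<close>
  have "(-1) ^ n * real_of_int (Fib_int (s + 1 - int n))
      = (-1) powi s * real_of_int (Fib_int (int n - s - 1))"
    using Fib_int_uminus[of "int n - s - 1"]
    by (auto simp: power_int_minus_left algebra_simps minus_one_power_iff)
  then show "2 * (\<Sum>k = 1..nat \<lceil>real n / 2\<rceil>.
            real (n choose (2 * k - 1)) * real_of_int (Fib_int (2 * int k + s)))
         = real_of_int (Fib_int (2 * int n + s + 1))
           - (-1) powi s * real_of_int (Fib_int (int n - s - 1))"
    by (subst sum_odd_choose_fib_rec[where G = "\<lambda>j. real_of_int (Fib_int j)"])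
       \<comment> \<open>The recurrence is used from right to left, as it would loop in the other
         direction.\<close>
       (simp_all flip: of_int_add Fib_int_rec)
next
  \<comment> \<open>Lucas reflection has the opposite sign to Fibonacci reflection, hence the minus
    here and the plus in the result.\<close>
  have "(-1) ^ n * real_of_int (Lucas_int (s + 1 - int n))
      = - ((-1) powi s * real_of_int (Lucas_int (int n - s - 1)))"
    using Lucas_int_uminus[of "int n - s - 1"]
    by (auto simp: power_int_minus_left algebra_simps minus_one_power_iff)
  then show "2 * (\<Sum>k = 1..nat \<lceil>real n / 2\<rceil>.
            real (n choose (2 * k - 1)) * real_of_int (Lucas_int (2 * int k + s)))
         = real_of_int (Lucas_int (2 * int n + s + 1))
           + (-1) powi s * real_of_int (Lucas_int (int n - s - 1))"
    by (subst sum_odd_choose_fib_rec[where G = "\<lambda>j. real_of_int (Lucas_int j)"])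
       (simp_all flip: of_int_add Lucas_int_rec)
qed

end
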